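(* The ordered spectrum $\lambda_{\le}(\mathcal{S}^{4,2})=\{\lambda\in\lambda(\mathcal{S}^{4,2}) : \lambda_1\le\lambda_2\le\lambda_3\le\lambda_4\}$ is not convex.
   Context: $\mathcal{S}^{4,2}$ is the set of real symmetric $4\times 4$ matrices all of whose $2\times 2$ principal submatrices are positive semidefinite. $\lambda(\mathcal{S}^{4,2})$ is the set of all $(\lambda_1,\dots,\lambda_4)\in\mathbb{R}^4$ such that some $X\in\mathcal{S}^{4,2}$ is similar to $\operatorname{diag}(\lambda_1,\dots,\lambda_4)$. *)

theory Defs
  imports "HOL-Analysis.Analysis"
begin

definition symmetric_matrix :: "real ^ 'n ^ 'n \<Rightarrow> bool" where
  "symmetric_matrix A \<longleftrightarrow> transpose A = A"

definition psd_matrix :: "real ^ 'n ^ 'n \<Rightarrow> bool" where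
  "psd_matrix A \<longleftrightarrow> symmetric_matrix A \<and> (\<forall>x. x \<bullet> (A *v x) \<ge> 0)"

text \<open>
  For an injective index map f, this is the principal submatrix whose rows and columns are both
  indexed by the range of f.  Injections that are not increasing give a simultaneous permutation of
  rows and columns of the usual principal submatrix, which does not affect semidefiniteness.
\<close>

definition principal_submatrix :: "('k \<Rightarrow> 'n) \<Rightarrow> real ^ 'n ^ 'n \<Rightarrow> real ^ 'k ^ 'k" where
  "principal_submatrix f A = (\<chi> i j. A $ f i $ f j)"

definition diagonal_matrix :: "real ^ 'n \<Rightarrow> real ^ 'n ^ 'n" where
  "diagonal_matrix v = (\<chi> i j. if i = j then v $ i else 0)"

definition similar_matrices :: "real ^ 'n ^ 'n \<Rightarrow> real ^ 'n ^ 'n \<Rightarrow> bool" where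
  "similar_matrices A B \<longleftrightarrow> (\<exists>P. invertible P \<and> A = P ** B ** matrix_inv P)"

definition S42 :: "(real ^ 4 ^ 4) set" where
  "S42 = {X. symmetric_matrix X \<and>
             (\<forall>f :: 2 \<Rightarrow> 4. inj f \<longrightarrow> psd_matrix (principal_submatrix f X))}"

definition spectrum_set :: "(real ^ 'n ^ 'n) set \<Rightarrow> (real ^ 'n) set" where
  "spectrum_set S = {l. \<exists>X \<in> S. similar_matrices X (diagonal_matrix l)}"

text \<open>
  The inequalities are spelled out because in the numeral type 4 the index 4 equals 0, so the
  order on that type is not the order 1, 2, 3, 4 of the coordinates.
\<close>

definition ordered_spectrum_set :: "(real ^ 4 ^ 4) set \<Rightarrow> (real ^ 4) set" where
  "ordered_spectrum_set S =
     {l \<in> spectrum_set S. l $ 1 \<le> l $ 2 \<and> l $ 2 \<le> l $ 3 \<and> l $ 3 \<le> l $ 4}"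

end

theory Submission
  imports Defs
begin

text \<open>
  Write \<open>e\<^sub>2\<close> for the sum of the six principal 2x2 minors of a symmetric 4x4 matrix, that is, for the
  second elementary symmetric function of its eigenvalues. Every matrix in S42 satisfies
  \<open>4 det X \<le> e\<^sub>2\<^sup>2\<close> (\<open>S42_det_le\<close>), an inequality between symmetric functions of the eigenvalues.
  It is violated by the midpoint of two ordered spectra of S42.

  The inequality comes from the identity
  \<open>det X = m\<^sub>1\<^sub>2 m\<^sub>3\<^sub>4 + m\<^sub>1\<^sub>3 m\<^sub>2\<^sub>4 + m\<^sub>1\<^sub>4 m\<^sub>2\<^sub>3 - 2 N\<close>, where \<open>m\<^sub>i\<^sub>j\<close> are the principal 2x2 minors
  and the remainder N is affine in each off-diagonal entry. After scaling the diagonal to 1,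
  the entries range over the cube \<open>[-1, 1]\<^sup>6\<close>, and a multiaffine function that is nonnegative
  at the vertices of a cube is nonnegative on all of it. At the vertices the minors vanish, so there
  \<open>N = - det X / 2\<close>, and a sign matrix has determinant 0 or -16. Hence N is nonnegative
  (\<open>multiaffine_remainder_nonneg\<close>), and the arithmetic-geometric mean inequality bounds the three
  products of complementary minors by \<open>e\<^sub>2\<^sup>2 / 4\<close>.

  Why convexity should fail: a spectrum such as (-1, 0, 2, 2) has \<open>e\<^sub>2 = 0\<close> and determinant 0.
  On a segment starting there and ending at a spectrum with two negative and two positive
  eigenvalues, both \<open>e\<^sub>2\<close> and the determinant grow linearly at first, so that the determinant
  dominates \<open>e\<^sub>2\<^sup>2 / 4\<close>. Scaling the starting point by 16 brings the midpoint of the segment into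
  this range.
\<close>

section \<open>Determinants of 4x4 matrices\<close>

lemma det_4:
  fixes A :: "'a::comm_ring_1 ^ 4 ^ 4"
  shows "det A =
    A$1$1 * (A$2$2 * A$3$3 * A$4$4 + A$2$3 * A$3$4 * A$4$2 + A$2$4 * A$3$2 * A$4$3
      - A$2$2 * A$3$4 * A$4$3 - A$2$3 * A$3$2 * A$4$4 - A$2$4 * A$3$3 * A$4$2)
  - A$1$2 * (A$2$1 * A$3$3 * A$4$4 + A$2$3 * A$3$4 * A$4$1 + A$2$4 * A$3$1 * A$4$3
      - A$2$1 * A$3$4 * A$4$3 - A$2$3 * A$3$1 * A$4$4 - A$2$4 * A$3$3 * A$4$1)
  + A$1$3 * (A$2$1 * A$3$2 * A$4$4 + A$2$2 * A$3$4 * A$4$1 + A$2$4 * A$3$1 * A$4$2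
      - A$2$1 * A$3$4 * A$4$2 - A$2$2 * A$3$1 * A$4$4 - A$2$4 * A$3$2 * A$4$1)
  - A$1$4 * (A$2$1 * A$3$2 * A$4$3 + A$2$2 * A$3$3 * A$4$1 + A$2$3 * A$3$1 * A$4$2
      - A$2$1 * A$3$3 * A$4$2 - A$2$2 * A$3$1 * A$4$3 - A$2$3 * A$3$2 * A$4$1)"
proof -
  have f1: "finite {2::4, 3, 4}" "1 \<notin> {2::4, 3, 4}" by auto
  have f2: "finite {3::4, 4}" "2 \<notin> {3::4, 4}" by auto
  have f3: "finite {4::4}" "3 \<notin> {4::4}" by auto
  show ?thesis
    unfolding det_def UNIV_4
    unfolding sum_over_permutations_insert[OF f1] sum_over_permutations_insert[OF f2]
      sum_over_permutations_insert[OF f3] permutes_sing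
    by (simp add: sign_swap_id permutation_swap_id sign_compose sign_id swap_id_eq
        permutation_compose algebra_simps)
qed

section \<open>The multiaffine remainder\<close>

text \<open>
  The function is affine in \<open>c12\<close>, so it suffices to look at the two faces \<open>c12 = 1\<close> and \<open>c12 = -1\<close>.
  On the first it equals \<open>(1 - a b) (1 - c d) - e (a - b) (c - d)\<close>, where each difference is
  dominated by the corresponding factor. The second face turns into the first on changing the
  signs of \<open>c23\<close> and \<open>c24\<close>, which amounts to negating the second row and column of the matrix.
\<close>

lemma multiaffine_nonneg_on_cube:
  fixes c12 c13 c14 c23 c24 c34 :: real
  assumes "\<bar>c12\<bar> \<le> 1" "\<bar>c13\<bar> \<le> 1" "\<bar>c14\<bar> \<le> 1" "\<bar>c23\<bar> \<le> 1" "\<bar>c24\<bar> \<le> 1" "\<bar>c34\<bar> \<le> 1"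
  shows "0 \<le> 1 + c12 * c34 * (c13 * c24) + c12 * c34 * (c14 * c23) + c13 * c24 * (c14 * c23)
      - c12 * c13 * c23 - c12 * c14 * c24 - c13 * c14 * c34 - c23 * c24 * c34" (is "0 \<le> ?N")
proof -
  have diff_le: "\<bar>a - b\<bar> \<le> 1 - a * b" if "\<bar>a\<bar> \<le> 1" "\<bar>b\<bar> \<le> 1" for a b :: real
  proof -
    have "0 \<le> (1 - a) * (1 + b)" "0 \<le> (1 + a) * (1 - b)"
      using that by (auto intro!: mult_nonneg_nonneg)
    then show ?thesis by (simp add: algebra_simps abs_le_iff)
  qed
  have face: "0 \<le> (1 - a * b) * (1 - c * d) - e * ((a - b) * (c - d))"
    if "\<bar>a\<bar> \<le> 1" "\<bar>b\<bar> \<le> 1" "\<bar>c\<bar> \<le> 1" "\<bar>d\<bar> \<le> 1" "\<bar>e\<bar> \<le> 1" for a b c d e :: real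
  proof -
    have "e * ((a - b) * (c - d)) \<le> \<bar>e\<bar> * (\<bar>a - b\<bar> * \<bar>c - d\<bar>)"
      by (metis abs_ge_self abs_mult)
    also have "\<dots> \<le> 1 * ((1 - a * b) * (1 - c * d))"
      using diff_le[OF that(1,2)] diff_le[OF that(3,4)] that(5)
      by (intro mult_mono) auto
    finally show ?thesis by simp
  qed
  define F1 where "F1 = (1 - c13 * c23) * (1 - c14 * c24) - c34 * ((c13 - c23) * (c14 - c24))"
  define F2 where "F2 = (1 + c13 * c23) * (1 + c14 * c24) - c34 * ((c13 + c23) * (c14 + c24))"
  have "0 \<le> F1"
    unfolding F1_def using assms by (intro face)
  moreover have "0 \<le> F2"
    unfolding F2_def using face[of c13 "- c23" c14 "- c24" c34] assms by simp
  ultimately have "0 \<le> (1 + c12) / 2 * F1 + (1 - c12) / 2 * F2"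
    using assms(1) by (intro add_nonneg_nonneg mult_nonneg_nonneg) auto
  also have "(1 + c12) / 2 * F1 + (1 - c12) / 2 * F2 = ?N"
    unfolding F1_def F2_def by (simp add: field_simps)
  finally show ?thesis .
qed

text \<open>
  This factors a bounded off-diagonal entry through the square roots of the diagonal entries, as in
  passing from a covariance to a correlation. Zero diagonal entries force x to vanish.
\<close>

lemma scaled_entry:
  fixes x p q :: real
  assumes "0 \<le> p" "0 \<le> q" "x\<^sup>2 \<le> p * q"
  obtains c where "\<bar>c\<bar> \<le> 1" "x = sqrt p * sqrt q * c"
proof -
  have le: "\<bar>x\<bar> \<le> sqrt p * sqrt q"
    using real_sqrt_le_mono[OF assms(3)] by (simp add: real_sqrt_mult)
  show ?thesis
  proof (cases "sqrt p * sqrt q = 0")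
    case True
    with le have "x = 0" by simp
    then show ?thesis using that[of 0] by simp
  next
    case False
    with le have "\<bar>x / (sqrt p * sqrt q)\<bar> \<le> 1"
      using assms(1,2) by (simp add: abs_mult divide_le_eq)
    then show ?thesis using that[of "x / (sqrt p * sqrt q)"] False by simp
  qed
qed

lemma multiaffine_remainder_nonneg:
  fixes a1 a2 a3 a4 x12 x13 x14 x23 x24 x34 :: real
  assumes a: "0 \<le> a1" "0 \<le> a2" "0 \<le> a3" "0 \<le> a4"
    and x: "x12\<^sup>2 \<le> a1 * a2" "x13\<^sup>2 \<le> a1 * a3" "x14\<^sup>2 \<le> a1 * a4"
      "x23\<^sup>2 \<le> a2 * a3" "x24\<^sup>2 \<le> a2 * a4" "x34\<^sup>2 \<le> a3 * a4"
  shows "0 \<le> a1 * a2 * a3 * a4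
      + x12 * x34 * (x13 * x24) + x12 * x34 * (x14 * x23) + x13 * x24 * (x14 * x23)
      - x12 * x13 * x23 * a4 - x12 * x14 * x24 * a3 - x13 * x14 * x34 * a2 - x23 * x24 * x34 * a1"
proof -
  define d1 d2 d3 d4 where d: "d1 = sqrt a1" "d2 = sqrt a2" "d3 = sqrt a3" "d4 = sqrt a4"
  have sq: "a1 = d1 * d1" "a2 = d2 * d2" "a3 = d3 * d3" "a4 = d4 * d4"
    using a by (simp_all add: d)
  obtain c12 where c12: "\<bar>c12\<bar> \<le> 1" "x12 = d1 * d2 * c12"
    using scaled_entry[OF a(1,2) x(1)] unfolding d by blast
  obtain c13 where c13: "\<bar>c13\<bar> \<le> 1" "x13 = d1 * d3 * c13"
    using scaled_entry[OF a(1,3) x(2)] unfolding d by blast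
  obtain c14 where c14: "\<bar>c14\<bar> \<le> 1" "x14 = d1 * d4 * c14"
    using scaled_entry[OF a(1,4) x(3)] unfolding d by blast
  obtain c23 where c23: "\<bar>c23\<bar> \<le> 1" "x23 = d2 * d3 * c23"
    using scaled_entry[OF a(2,3) x(4)] unfolding d by blast
  obtain c24 where c24: "\<bar>c24\<bar> \<le> 1" "x24 = d2 * d4 * c24"
    using scaled_entry[OF a(2,4) x(5)] unfolding d by blast
  obtain c34 where c34: "\<bar>c34\<bar> \<le> 1" "x34 = d3 * d4 * c34"
    using scaled_entry[OF a(3,4) x(6)] unfolding d by blast
  have "0 \<le> (d1 * d2 * d3 * d4)\<^sup>2 *
     (1 + c12 * c34 * (c13 * c24) + c12 * c34 * (c14 * c23) + c13 * c24 * (c14 * c23)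
      - c12 * c13 * c23 - c12 * c14 * c24 - c13 * c14 * c34 - c23 * c24 * c34)"
    by (intro mult_nonneg_nonneg multiaffine_nonneg_on_cube zero_le_power2
        c12(1) c13(1) c14(1) c23(1) c24(1) c34(1))
  then show ?thesis
    unfolding sq c12(2) c13(2) c14(2) c23(2) c24(2) c34(2)
    by (simp add: algebra_simps power2_eq_square)
qed

section \<open>A determinantal inequality on S42\<close>

lemma psd_matrix_2_iff:
  fixes A :: "real ^ 2 ^ 2"
  shows "psd_matrix A \<longleftrightarrow>
    A$2$1 = A$1$2 \<and> 0 \<le> A$1$1 \<and> 0 \<le> A$2$2 \<and> (A$1$2)\<^sup>2 \<le> A$1$1 * A$2$2"
proof -
  define a b c where abc: "a = A$1$1" "b = A$1$2" "c = A$2$2"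
  have sym: "symmetric_matrix A \<longleftrightarrow> A$2$1 = b"
    by (auto simp: symmetric_matrix_def vec_eq_iff forall_2 Finite_Cartesian_Product.transpose_def abc)
  have form: "x \<bullet> (A *v x) = a * (x$1)\<^sup>2 + 2 * b * x$1 * x$2 + c * (x$2)\<^sup>2"
    if "A$2$1 = b" for x
    using that by (simp add: inner_vec_def matrix_vector_mult_def sum_2 abc algebra_simps power2_eq_square)
  have "(\<forall>x :: real ^ 2. 0 \<le> a * (x$1)\<^sup>2 + 2 * b * x$1 * x$2 + c * (x$2)\<^sup>2) \<longleftrightarrow>
      0 \<le> a \<and> 0 \<le> c \<and> b\<^sup>2 \<le> a * c" (is "?L \<longleftrightarrow> ?R")
  proof
    assume ?L
    then have q: "0 \<le> a * u\<^sup>2 + 2 * b * u * v + c * v\<^sup>2" for u v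
      by (drule_tac x = "vector [u, v]" in spec) simp
    have ac: "0 \<le> a" "0 \<le> c"
      using q[of 1 0] q[of 0 1] by simp_all
    have "b\<^sup>2 \<le> a * c"
    proof (cases "a = 0")
      case True
      \<comment> \<open>The form is now \<open>v (2 b u + c v)\<close>; at \<open>v = b\<close>, \<open>u = - (c + 1)\<close> its value is \<open>- (c + 2) b\<^sup>2\<close>.\<close>
      have "0 \<le> - 2 * b\<^sup>2 * (c + 1) + c * b\<^sup>2"
        using q[of "- (c + 1)" b] True by (simp add: power2_eq_square algebra_simps)
      then have "(c + 2) * b\<^sup>2 \<le> 0" by (simp add: algebra_simps)
      then have "b = 0"
        using ac by (simp add: mult_le_0_iff)
      then show ?thesis using True by simp
    next
      case False
      have "0 \<le> a * (a * c - b\<^sup>2)"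
        using q[of "- b" a] by (simp add: power2_eq_square algebra_simps)
      then show ?thesis using False ac by (simp add: zero_le_mult_iff)
    qed
    with ac show ?R by simp
  next
    assume R: ?R
    show ?L
    proof
      fix x :: "real ^ 2"
      define u v where uv: "u = x$1" "v = x$2"
      show "0 \<le> a * (x$1)\<^sup>2 + 2 * b * x$1 * x$2 + c * (x$2)\<^sup>2"
      proof (cases "a = 0")
        case True
        then show ?thesis using R by simp
      next
        case False
        have "0 \<le> (a * u + b * v)\<^sup>2 + (a * c - b\<^sup>2) * v\<^sup>2"
          using R by simp
        also have "\<dots> = a * (a * u\<^sup>2 + 2 * b * u * v + c * v\<^sup>2)"
          by (simp add: power2_eq_square algebra_simps)
        finally show ?thesis using False R by (simp add: zero_le_mult_iff uv)
      qed
    qed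
  qed
  then show ?thesis
    unfolding psd_matrix_def sym using form by (auto simp: abc)
qed

lemma S42_iff:
  "X \<in> S42 \<longleftrightarrow> symmetric_matrix X \<and>
     (\<forall>i. 0 \<le> X$i$i) \<and> (\<forall>i j. i \<noteq> j \<longrightarrow> (X$i$j)\<^sup>2 \<le> X$i$i * X$j$j)"
proof -
  have "(\<forall>f :: 2 \<Rightarrow> 4. inj f \<longrightarrow> psd_matrix (principal_submatrix f X)) \<longleftrightarrow>
     (\<forall>i. 0 \<le> X$i$i) \<and> (\<forall>i j. i \<noteq> j \<longrightarrow> (X$i$j)\<^sup>2 \<le> X$i$i * X$j$j)" (is "?L \<longleftrightarrow> ?R")
    if sym: "\<And>i j. X$j$i = X$i$j"
  proof
    assume L: ?L
    have pair: "0 \<le> X$i$i \<and> (X$i$j)\<^sup>2 \<le> X$i$i * X$j$j" if "i \<noteq> j" for i j :: 4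
    proof -
      have "inj (\<lambda>k :: 2. if k = 1 then i else j)"
        using that by (auto simp: inj_def forall_2)
      with L have "psd_matrix (principal_submatrix (\<lambda>k :: 2. if k = 1 then i else j) X)"
        by blast
      then show ?thesis
        by (simp add: psd_matrix_2_iff principal_submatrix_def)
    qed
    moreover have "\<exists>j. j \<noteq> i" for i :: 4
      by (metis zero_neq_one)
    ultimately show ?R by metis
  next
    assume R: ?R
    show ?L
    proof (intro allI impI)
      fix f :: "2 \<Rightarrow> 4"
      assume "inj f"
      then have "f 1 \<noteq> f 2" by (simp add: inj_eq)
      then show "psd_matrix (principal_submatrix f X)"
        using R sym by (auto simp: psd_matrix_2_iff principal_submatrix_def)
    qed
  qed
  then show ?thesis
    by (auto simp: S42_def symmetric_matrix_def vec_eq_iff Finite_Cartesian_Product.transpose_def)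
qed

text \<open>
  In terms of the eigenvalues, \<open>(trace X)\<^sup>2 - trace (X ** X)\<close> is \<open>2 e\<^sub>2\<close>; traces are used because they
  are visibly invariant under similarity. The bound is attained at the identity plus the adjacency
  matrix of a 4-cycle with one negative edge, whose spectrum is \<open>1 \<plusminus> \<surd>2\<close>, each twice:
  there \<open>det X = 1\<close> and \<open>e\<^sub>2 = 2\<close>.
\<close>

lemma S42_det_le:
  assumes X: "X \<in> S42"
  shows "16 * det X \<le> ((trace X)\<^sup>2 - trace (X ** X))\<^sup>2"
proof -
  have sym: "X$j$i = X$i$j" for i j
    using X by (simp add: S42_iff symmetric_matrix_def vec_eq_iff Finite_Cartesian_Product.transpose_def)
  define a1 a2 a3 a4 where a: "a1 = X$1$1" "a2 = X$2$2" "a3 = X$3$3" "a4 = X$4$4"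
  define x12 x13 x14 x23 x24 x34 where x: "x12 = X$1$2" "x13 = X$1$3" "x14 = X$1$4"
    "x23 = X$2$3" "x24 = X$2$4" "x34 = X$3$4"
  have nonneg: "0 \<le> X$i$i" for i
    using X unfolding S42_iff by blast
  have minor: "(X$i$j)\<^sup>2 \<le> X$i$i * X$j$j" if "i \<noteq> j" for i j
    using X that unfolding S42_iff by blast
  define m12 m13 m14 m23 m24 m34 where m: "m12 = a1 * a2 - x12\<^sup>2" "m13 = a1 * a3 - x13\<^sup>2"
    "m14 = a1 * a4 - x14\<^sup>2" "m23 = a2 * a3 - x23\<^sup>2" "m24 = a2 * a4 - x24\<^sup>2" "m34 = a3 * a4 - x34\<^sup>2"
  have m_nonneg: "0 \<le> m12" "0 \<le> m13" "0 \<le> m14" "0 \<le> m23" "0 \<le> m24" "0 \<le> m34"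
    using minor[of 1 2] minor[of 1 3] minor[of 1 4] minor[of 2 3] minor[of 2 4] minor[of 3 4]
    by (simp_all add: m a x)
  have e2: "(trace X)\<^sup>2 - trace (X ** X) = 2 * (m12 + m34 + (m13 + m24) + (m14 + m23))"
    by (simp add: trace_def matrix_matrix_mult_def sum_4 sym[of 2 1] sym[of 3 1] sym[of 4 1]
        sym[of 3 2] sym[of 4 2] sym[of 4 3] m a x power2_eq_square algebra_simps)
  define N where "N = a1 * a2 * a3 * a4
      + x12 * x34 * (x13 * x24) + x12 * x34 * (x14 * x23) + x13 * x24 * (x14 * x23)
      - x12 * x13 * x23 * a4 - x12 * x14 * x24 * a3 - x13 * x14 * x34 * a2 - x23 * x24 * x34 * a1"
  have "0 \<le> N"
    unfolding N_def
    using nonneg minor[of 1 2] minor[of 1 3] minor[of 1 4] minor[of 2 3] minor[of 2 4] minor[of 3 4]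
    by (intro multiaffine_remainder_nonneg) (simp_all add: a x)
  moreover have "det X = m12 * m34 + m13 * m24 + m14 * m23 - 2 * N"
    by (simp add: det_4 sym[of 2 1] sym[of 3 1] sym[of 4 1]
        sym[of 3 2] sym[of 4 2] sym[of 4 3] N_def m a x power2_eq_square algebra_simps)
  ultimately have "16 * det X \<le> 4 * (4 * (m12 * m34) + 4 * (m13 * m24) + 4 * (m14 * m23))"
    by simp
  also have "\<dots> \<le> 4 * ((m12 + m34)\<^sup>2 + (m13 + m24)\<^sup>2 + (m14 + m23)\<^sup>2)"
  proof -
    have am_gm: "4 * (p * q) \<le> (p + q)\<^sup>2" for p q :: real
      using zero_le_power2[of "p - q"] by (simp add: power2_eq_square algebra_simps)
    show ?thesis
      using am_gm[of m12 m34] am_gm[of m13 m24] am_gm[of m14 m23] by simp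
  qed
  also have "\<dots> \<le> 4 * (m12 + m34 + (m13 + m24) + (m14 + m23))\<^sup>2"
  proof -
    have "p\<^sup>2 + q\<^sup>2 + r\<^sup>2 \<le> (p + q + r)\<^sup>2" if "0 \<le> p" "0 \<le> q" "0 \<le> r" for p q r :: real
      using mult_nonneg_nonneg[OF that(1,2)] mult_nonneg_nonneg[OF that(1,3)]
        mult_nonneg_nonneg[OF that(2,3)] by (simp add: power2_eq_square algebra_simps)
    then have "(m12 + m34)\<^sup>2 + (m13 + m24)\<^sup>2 + (m14 + m23)\<^sup>2
        \<le> (m12 + m34 + (m13 + m24) + (m14 + m23))\<^sup>2"
      using m_nonneg by simp
    then show ?thesis by simp
  qed
  also have "\<dots> = ((trace X)\<^sup>2 - trace (X ** X))\<^sup>2"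
    by (simp only: e2 power_mult_distrib) simp
  finally show ?thesis .
qed

section \<open>Similarity\<close>

lemma matrix_inv_inverse:
  fixes P :: "real ^ 'n ^ 'n"
  assumes "invertible P"
  shows "P ** matrix_inv P = mat 1" "matrix_inv P ** P = mat 1"
  using someI_ex[OF assms[unfolded invertible_def]] unfolding matrix_inv_def by auto

lemma similar_matrices_invariants:
  fixes A B :: "real ^ 'n ^ 'n"
  assumes "similar_matrices A B"
  shows "trace A = trace B" "trace (A ** A) = trace (B ** B)" "det A = det B"
proof -
  obtain P where P: "invertible P" and A: "A = P ** B ** matrix_inv P"
    using assms unfolding similar_matrices_def by blast
  note inv = matrix_inv_inverse[OF P]
  have tr: "trace (P ** M ** matrix_inv P) = trace M" for M
    by (subst trace_mul_sym) (simp add: matrix_mul_assoc inv)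
  show "trace A = trace B"
    unfolding A by (rule tr)
  have "A ** A = P ** B ** (matrix_inv P ** P) ** B ** matrix_inv P"
    unfolding A by (simp only: matrix_mul_assoc)
  also have "\<dots> = P ** (B ** B) ** matrix_inv P"
    by (simp add: inv matrix_mul_assoc)
  finally show "trace (A ** A) = trace (B ** B)"
    by (simp add: tr)
  have "det P * det (matrix_inv P) = 1"
    by (metis inv(1) det_mul det_I)
  then show "det A = det B"
    unfolding A det_mul by (simp add: mult.commute mult.left_commute)
qed

lemma similar_matricesI:
  fixes A B P Q :: "real ^ 'n ^ 'n"
  assumes "Q ** P = mat 1" "A ** P = P ** B"
  shows "similar_matrices A B"
proof -
  have P: "invertible P"
    using assms(1) by (auto simp: invertible_def matrix_left_right_inverse)
  have "A = A ** (P ** matrix_inv P)"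
    by (simp add: matrix_inv_inverse(1)[OF P])
  also have "\<dots> = P ** B ** matrix_inv P"
    by (simp add: matrix_mul_assoc assms(2))
  finally show ?thesis
    unfolding similar_matrices_def using P by blast
qed

section \<open>Two spectra and their midpoint\<close>

definition vec4 :: "'a \<Rightarrow> 'a \<Rightarrow> 'a \<Rightarrow> 'a \<Rightarrow> 'a ^ 4" where
  "vec4 a b c d = (\<chi> i. if i = 1 then a else if i = 2 then b else if i = 3 then c else d)"

lemma vec4_nth [simp]:
  "vec4 a b c d $ 1 = a" "vec4 a b c d $ 2 = b" "vec4 a b c d $ 3 = c" "vec4 a b c d $ 4 = d"
  by (simp_all add: vec4_def)

lemmas mat4_simps = vec_eq_iff forall_4 matrix_matrix_mult_def sum_4 diagonal_matrix_def mat_def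

text \<open>
  A 4-cycle with weights 8, 6, 8, 6 and one negative edge has an adjacency matrix B with
  \<open>B\<^sup>2 = (8\<^sup>2 + 6\<^sup>2) I\<close> and trace 0, hence the double eigenvalues 10 and -10. Adding 8 I
  makes the 2x2 principal minors nonnegative and leaves two negative eigenvalues. The
  eigenvectors in P are pairwise orthogonal of squared length 50.
\<close>

lemma mem_ordered_spectrum1: "vec4 (-2) (-2) 18 18 \<in> ordered_spectrum_set S42"
proof -
  define X :: "real ^ 4 ^ 4" where
    "X = vec4 (vec4 8 (-8) 0 6) (vec4 (-8) 8 6 0) (vec4 0 6 8 8) (vec4 6 0 8 8)"
  define P :: "real ^ 4 ^ 4" where
    "P = vec4 (vec4 (-5) 0 5 0) (vec4 (-4) 3 (-4) 3) (vec4 0 (-5) 0 5) (vec4 3 4 3 4)"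
  have "similar_matrices X (diagonal_matrix (vec4 (-2) (-2) 18 18))"
    by (rule similar_matricesI[where P = P and Q = "(1/50) *\<^sub>R transpose P"])
      (simp_all add: X_def P_def mat4_simps Finite_Cartesian_Product.transpose_def)
  moreover have "X \<in> S42"
    by (simp add: S42_iff X_def symmetric_matrix_def vec_eq_iff forall_4
        Finite_Cartesian_Product.transpose_def)
  ultimately show ?thesis
    by (auto simp: ordered_spectrum_set_def spectrum_set_def)
qed

text \<open>
  On the first three coordinates the matrix is \<open>16 (2 I - J)\<close> with J the all-ones matrix, all of
  whose 2x2 principal minors vanish. The eigenvectors in P are again pairwise orthogonal, so the
  rows of Q are the columns of P divided by their squared lengths.
\<close>

lemma mem_ordered_spectrum2: "vec4 (-16) 0 32 32 \<in> ordered_spectrum_set S42"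
proof -
  define X :: "real ^ 4 ^ 4" where
    "X = vec4 (vec4 16 (-16) (-16) 0) (vec4 (-16) 16 (-16) 0) (vec4 (-16) (-16) 16 0) (vec4 0 0 0 0)"
  define P :: "real ^ 4 ^ 4" where
    "P = vec4 (vec4 1 0 1 1) (vec4 1 0 (-1) 1) (vec4 1 0 0 (-2)) (vec4 0 1 0 0)"
  define Q :: "real ^ 4 ^ 4" where
    "Q = vec4 (vec4 (1/3) (1/3) (1/3) 0) (vec4 0 0 0 1) (vec4 (1/2) (-1/2) 0 0) (vec4 (1/6) (1/6) (-1/3) 0)"
  have "similar_matrices X (diagonal_matrix (vec4 (-16) 0 32 32))"
    by (rule similar_matricesI[where P = P and Q = Q])
      (simp_all add: X_def P_def Q_def mat4_simps)
  moreover have "X \<in> S42"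
    by (simp add: S42_iff X_def symmetric_matrix_def vec_eq_iff forall_4
        Finite_Cartesian_Product.transpose_def)
  ultimately show ?thesis
    by (auto simp: ordered_spectrum_set_def spectrum_set_def)
qed

lemma midpoint_notin_spectrum: "vec4 (-9) (-1) 25 25 \<notin> spectrum_set S42"
proof
  let ?D = "diagonal_matrix (vec4 (-9) (-1) 25 25 :: real ^ 4)"
  assume "vec4 (-9) (-1) 25 25 \<in> spectrum_set S42"
  then obtain X where X: "X \<in> S42" "similar_matrices X ?D"
    by (auto simp: spectrum_set_def)
  have "trace ?D = 40" "trace (?D ** ?D) = 1332" "det ?D = 5625"
    by (simp_all add: trace_def det_4 mat4_simps)
  with S42_det_le[OF X(1)] show False
    by (simp add: similar_matrices_invariants[OF X(2)])
qed

theorem mainTheorem4: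
  shows "\<not> convex (ordered_spectrum_set S42)"
proof
  assume "convex (ordered_spectrum_set S42)"
  from convexD[OF this mem_ordered_spectrum1 mem_ordered_spectrum2, of "1/2" "1/2"]
  have "(1/2) *\<^sub>R vec4 (-2) (-2) 18 18 + (1/2) *\<^sub>R vec4 (-16) 0 32 32 \<in> spectrum_set S42"
    by (simp add: ordered_spectrum_set_def)
  also have "(1/2) *\<^sub>R vec4 (-2) (-2) 18 18 + (1/2) *\<^sub>R vec4 (-16) 0 32 32
      = (vec4 (-9) (-1) 25 25 :: real ^ 4)"
    by (simp add: vec_eq_iff forall_4)
  finally show False
    using midpoint_notin_spectrum by contradiction
qed

end
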